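(* For all $k\ge1$, as formal power series in $t$, $$\sum_{n\ge k}\overline{\mathbf{SF}}_{n,k}(q)\,t^n=\frac{t^k}{(1-[F_1]_qt)(1-[F_2]_qt)\cdots(1-[F_k]_qt)}.$$
   Context: Fibonacci numbers: $F_0=0$, $F_1=1$, $F_m=F_{m-1}+F_{m-2}$. For any integer $m$, $[m]_q=\frac{1-q^m}{1-q}$. For $k\ge0$ let $\overline{[x]}_{\downarrow_{q,F,k}}=\prod_{i=0}^{k-1}([x]_q-[F_i]_q)$ (empty product $=1$). For $n\ge0$, $\overline{\mathbf{SF}}_{n,k}(q)$ ($0\le k\le n$) are the unique rational functions of $q$ with $[x]_q^n=\sum_{k=0}^n\overline{\mathbf{SF}}_{n,k}(q)\overline{[x]}_{\downarrow_{q,F,k}}$ for all positive integers $x$. *)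

theory Defs
  imports
    "HOL-Computational_Algebra.Computational_Algebra"
    "HOL-Number_Theory.Fib"
begin

text \<open>
  Rational functions of \<open>q\<close> over a field \<open>'a\<close> of characteristic 0 are elements of \<^typ>\<open>'a poly fract\<close>.
\<close>

definition qvar :: "'a::field_char_0 poly fract" where
  "qvar = to_fract [:0, 1:]"

definition qint :: "int \<Rightarrow> 'a::field_char_0 poly fract" where
  "qint m = (1 - qvar powi m) / (1 - qvar)"

definition qfib_falling :: "int \<Rightarrow> nat \<Rightarrow> 'a::field_char_0 poly fract" where
  "qfib_falling x k = (\<Prod>i<k. qint x - qint (int (fib i)))"

text \<open>
  \<open>SF n k\<close> is meaningful for \<open>k \<le> n\<close>. The clause on \<open>k > n\<close> only makes the coefficient
  sequence unique as a total function; see \<open>SF_ex1\<close>.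
\<close>

definition is_SF_row :: "nat \<Rightarrow> (nat \<Rightarrow> 'a::field_char_0 poly fract) \<Rightarrow> bool" where
  "is_SF_row n c \<longleftrightarrow>
     (\<forall>k>n. c k = 0) \<and>
     (\<forall>x::int. x > 0 \<longrightarrow> qint x ^ n = (\<Sum>k\<le>n. c k * qfib_falling x k))"

definition SF :: "nat \<Rightarrow> nat \<Rightarrow> 'a::field_char_0 poly fract" where
  "SF n = (THE c. is_SF_row n c)"

lemma inj_qvar_power: "inj (\<lambda>n::nat. (qvar :: 'a::field_char_0 poly fract) ^ n)"
proof (rule injI)
  fix m n :: nat
  assume eq: "(qvar :: 'a poly fract) ^ m = qvar ^ n"
  have pow: "(qvar :: 'a poly fract) ^ j = to_fract (monom 1 j)" for j
    by (induction j) (simp_all add: qvar_def monom_Suc flip: to_fract_mult)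
  have "degree (monom (1::'a) m) = degree (monom (1::'a) n)"
    using eq by (simp add: pow)
  then show "m = n"
    by (simp add: degree_monom_eq)
qed

lemma infinite_qint_pos: "infinite (qint ` {x::int. x > 0} :: 'a::field_char_0 poly fract set)"
proof -
  have ne: "(qvar :: 'a poly fract) \<noteq> 1"
    using injD[OF inj_qvar_power[where 'a = 'a], of 1 0] by auto
  have "inj (\<lambda>n::nat. qint (int (Suc n)) :: 'a poly fract)"
  proof (rule injI)
    fix m n :: nat
    assume "(qint (int (Suc m)) :: 'a poly fract) = qint (int (Suc n))"
    then have "(qvar :: 'a poly fract) ^ Suc m = qvar ^ Suc n"
      using ne unfolding qint_def power_int_of_nat by (simp del: power_Suc)
    then show "m = n"
      using injD[OF inj_qvar_power[where 'a = 'a], of "Suc m" "Suc n"] by simp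
  qed
  then have "infinite (range (\<lambda>n::nat. qint (int (Suc n)) :: 'a poly fract))"
    by (rule range_inj_infinite)
  then show ?thesis
    by (rule infinite_super[rotated]) auto
qed

lemma is_SF_row_exists: "\<exists>c :: nat \<Rightarrow> 'a::field_char_0 poly fract. is_SF_row n c"
proof (induction n)
  case 0
  show ?case
    by (rule exI[of _ "\<lambda>k. if k = 0 then 1 else 0"]) (simp add: is_SF_row_def qfib_falling_def)
next
  case (Suc n)
  then obtain c :: "nat \<Rightarrow> 'a poly fract" where c: "is_SF_row n c"
    by blast
  define d where
    "d k = (case k of 0 \<Rightarrow> 0 | Suc j \<Rightarrow> c j) + qint (int (fib k)) * c k" for k
  have "qint x ^ Suc n = (\<Sum>k\<le>Suc n. d k * qfib_falling x k)" if "x > 0" for x :: int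
  proof -
    let ?f = "qfib_falling x :: nat \<Rightarrow> 'a poly fract"
    let ?F = "\<lambda>k. qint (int (fib k)) :: 'a poly fract"
    have step: "?f (Suc k) = (qint x - ?F k) * ?f k" for k
      by (simp add: qfib_falling_def)
    have c0: "c (Suc n) = 0"
      using c by (simp add: is_SF_row_def)
    have "qint x ^ Suc n = (\<Sum>k\<le>n. qint x * (c k * ?f k))"
      using c that by (simp add: is_SF_row_def sum_distrib_left)
    also have "\<dots> = (\<Sum>k\<le>n. c k * ?f (Suc k)) + (\<Sum>k\<le>n. ?F k * c k * ?f k)"
      by (simp add: step algebra_simps flip: sum.distrib)
    also have "(\<Sum>k\<le>n. c k * ?f (Suc k)) =
        (\<Sum>k\<le>Suc n. (case k of 0 \<Rightarrow> 0 | Suc j \<Rightarrow> c j) * ?f k)"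
      by (subst sum.atMost_Suc_shift) simp
    also have "(\<Sum>k\<le>n. ?F k * c k * ?f k) = (\<Sum>k\<le>Suc n. ?F k * c k * ?f k)"
      by (simp add: c0)
    finally show ?thesis
      by (simp only: d_def sum.distrib distrib_right)
  qed
  moreover have "d k = 0" if "k > Suc n" for k
    using c that by (auto simp: d_def is_SF_row_def split: nat.split)
  ultimately show ?case
    unfolding is_SF_row_def by blast
qed

lemma qfib_falling_independent:
  fixes d :: "nat \<Rightarrow> 'a::field_char_0 poly fract"
  assumes "\<And>x::int. x > 0 \<Longrightarrow> (\<Sum>k<n. d k * qfib_falling x k) = 0"
  shows "\<forall>k<n. d k = 0"
  using assms
proof (induction n)
  case 0
  then show ?case by simp
next
  case (Suc n)
  define P :: "nat \<Rightarrow> 'a poly fract poly" where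
    "P k = (\<Prod>i<k. [:- qint (int (fib i)), 1:])" for k
  define p where "p = (\<Sum>k<Suc n. smult (d k) (P k))"
  have P: "poly (P k) (qint x) = qfib_falling x k" for k x
    by (simp add: P_def poly_prod qfib_falling_def)
  have monic: "lead_coeff (P k) = 1" for k
    by (simp add: P_def lead_coeff_prod)
  have deg: "degree (P k) = k" for k
    unfolding P_def by (subst degree_prod_eq_sum_degree) auto
  have "poly p (qint x) = 0" if "x > 0" for x :: int
    using Suc.prems[OF that] by (simp add: p_def poly_sum P)
  then have "qint ` {x::int. x > 0} \<subseteq> {y. poly p y = 0}"
    by auto
  then have "p = 0"
    using infinite_qint_pos poly_roots_finite infinite_super by metis
  then have "coeff p n = 0"
    by simp
  moreover have "coeff p n = d n"
  proof -
    have "coeff (P k) n = 0" if "k < n" for k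
      using that by (intro coeff_eq_0) (simp add: deg)
    moreover have "coeff (P n) n = 1"
      using monic[of n] by (simp add: deg)
    ultimately show ?thesis
      by (simp add: p_def coeff_sum)
  qed
  ultimately have "d n = 0"
    by simp
  with Suc show ?case
    by (simp add: less_Suc_eq)
qed

lemma SF_ex1: "\<exists>!c :: nat \<Rightarrow> 'a::field_char_0 poly fract. is_SF_row n c"
proof (rule ex_ex1I[OF is_SF_row_exists])
  fix c d :: "nat \<Rightarrow> 'a poly fract"
  assume c: "is_SF_row n c" and d: "is_SF_row n d"
  have "(\<Sum>k<Suc n. (c k - d k) * qfib_falling x k) = 0" if "x > 0" for x :: int
    using c d that
    by (simp add: is_SF_row_def left_diff_distrib sum_subtractf lessThan_Suc_atMost
        del: sum.lessThan_Suc)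
  then have "\<forall>k<Suc n. c k - d k = 0"
    by (rule qfib_falling_independent)
  moreover have "c k = d k" if "k > n" for k
    using c d that by (simp add: is_SF_row_def)
  ultimately show "c = d"
    by (metis eq_iff_diff_eq_0 ext less_Suc_eq linorder_less_linear)
qed

end

theory Submission
  imports Defs
begin

text \<open>
  Multiplying the expansion of \<open>[x]\<^sup>n\<close> by \<open>[x] = ([x] - [F\<^sub>k]) + [F\<^sub>k]\<close> gives the triangular
  recurrence \<open>SF (n+1) (k+1) = SF n k + [F\<^sub>k\<^sub>+\<^sub>1] SF n (k+1)\<close>. For the column generating functions
  \<open>G\<^sub>k\<close> this says \<open>(1 - [F\<^sub>k\<^sub>+\<^sub>1] t) G\<^sub>k\<^sub>+\<^sub>1 = t G\<^sub>k\<close>, and \<open>G\<^sub>0 = 1\<close> because \<open>[F\<^sub>0] = 0\<close>.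
\<close>

text \<open>Stated for an arbitrary row \<open>c\<close>, so that uniqueness of rows turns it into
  the recurrences for \<open>SF\<close> below.\<close>

lemma is_SF_row_Suc:
  fixes c :: "nat \<Rightarrow> 'a::field_char_0 poly fract"
  assumes c: "is_SF_row n c"
  shows "is_SF_row (Suc n)
    (\<lambda>k. (case k of 0 \<Rightarrow> 0 | Suc j \<Rightarrow> c j) + qint (int (fib k)) * c k)"
  unfolding is_SF_row_def
proof (intro conjI allI impI)
  fix k assume "k > Suc n"
  then show "(case k of 0 \<Rightarrow> 0 | Suc j \<Rightarrow> c j) + qint (int (fib k)) * c k = 0"
    using c by (auto simp: is_SF_row_def split: nat.split)
next
  fix x :: int assume "x > 0"
  let ?f = "qfib_falling x :: nat \<Rightarrow> 'a poly fract"
  let ?F = "\<lambda>k. qint (int (fib k)) :: 'a poly fract"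
  have "c (Suc n) = 0"
    using c by (simp add: is_SF_row_def)
  have "qint x ^ Suc n = (\<Sum>k\<le>n. c k * (qint x * ?f k))"
    using c \<open>x > 0\<close> by (simp add: is_SF_row_def sum_distrib_left mult.left_commute)
  also have "\<dots> = (\<Sum>k\<le>n. c k * ?f (Suc k)) + (\<Sum>k\<le>n. ?F k * c k * ?f k)"
    by (simp add: qfib_falling_def algebra_simps flip: sum.distrib)
  \<comment> \<open>The first sum is shifted by one and gains a zero term at \<open>k = 0\<close>;
    the second gains a zero term at \<open>k = Suc n\<close>.\<close>
  also have "\<dots> = (\<Sum>k\<le>Suc n. (case k of 0 \<Rightarrow> 0 | Suc j \<Rightarrow> c j) * ?f k) +
      (\<Sum>k\<le>Suc n. ?F k * c k * ?f k)"
    by (subst sum.atMost_Suc_shift) (simp add: \<open>c (Suc n) = 0\<close>)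
  finally show "qint x ^ Suc n =
      (\<Sum>k\<le>Suc n. ((case k of 0 \<Rightarrow> 0 | Suc j \<Rightarrow> c j) + ?F k * c k) * ?f k)"
    by (simp only: sum.distrib distrib_right)
qed

lemma is_SF_row_SF: "is_SF_row n (SF n :: nat \<Rightarrow> 'a::field_char_0 poly fract)"
  unfolding SF_def by (rule theI'[OF SF_ex1])

lemma SF_eqI: "is_SF_row n c \<Longrightarrow> SF n = c"
  using SF_ex1 is_SF_row_SF by blast

lemma SF_eq_0: "n < k \<Longrightarrow> SF n k = 0"
  using is_SF_row_SF by (auto simp: is_SF_row_def)

lemma SF_0_0: "SF 0 0 = (1 :: 'a::field_char_0 poly fract)"
proof -
  have "is_SF_row 0 (\<lambda>k. if k = 0 then 1 else 0 :: 'a poly fract)"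
    by (simp add: is_SF_row_def qfib_falling_def)
  from SF_eqI[OF this] show ?thesis
    by simp
qed

lemma SF_Suc_0: "SF (Suc n) 0 = 0"
  by (subst SF_eqI[OF is_SF_row_Suc[OF is_SF_row_SF]]) (simp add: qint_def)

lemma SF_Suc_Suc: "SF (Suc n) (Suc k) = SF n k + qint (int (fib (Suc k))) * SF n (Suc k)"
  by (subst SF_eqI[OF is_SF_row_Suc[OF is_SF_row_SF]]) (simp del: fib.simps)

text \<open>Summing from \<open>n = 0\<close> adds only zero terms by \<open>SF_eq_0\<close> and
  spares a case distinction in the coefficients.\<close>

definition SF_gf :: "nat \<Rightarrow> 'a::field_char_0 poly fract fps" where
  "SF_gf k = Abs_fps (\<lambda>n. SF n k)"

lemma SF_gf_0: "SF_gf 0 = 1"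
proof (rule fps_ext)
  fix n show "SF_gf 0 $ n = (1 :: 'a poly fract fps) $ n"
    by (cases n) (simp_all add: SF_gf_def SF_0_0 SF_Suc_0)
qed

lemma SF_gf_Suc:
  "(1 - fps_const (qint (int (fib (Suc k)))) * fps_X) * SF_gf (Suc k) = fps_X * SF_gf k"
proof (rule fps_ext)
  fix n
  show "((1 - fps_const (qint (int (fib (Suc k)))) * fps_X) * SF_gf (Suc k)) $ n =
      (fps_X * SF_gf k :: 'a poly fract fps) $ n"
    \<comment> \<open>At \<open>n = 0\<close> the left side is \<open>SF 0 (Suc k) = 0\<close>; at a
      successor this is \<open>SF_Suc_Suc\<close>.\<close>
    by (cases n)
      (simp_all add: SF_gf_def SF_eq_0 SF_Suc_Suc left_diff_distrib mult.assoc del: fib.simps)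
qed

text \<open>Each induction step trades the last factor for one \<open>fps_X\<close> by
  \<open>SF_gf_Suc\<close>. The division-free form leaves a single cancellation for the end.\<close>

lemma prod_mult_SF_gf:
  "(\<Prod>i=1..k. 1 - fps_const (qint (int (fib i))) * fps_X) * SF_gf k = fps_X ^ k"
proof (induction k)
  case 0
  show ?case by (simp add: SF_gf_0)
next
  case (Suc k)
  let ?P = "\<Prod>i=1..k. 1 - fps_const (qint (int (fib i))) * fps_X :: 'a poly fract fps"
  have "(\<Prod>i=1..Suc k. 1 - fps_const (qint (int (fib i))) * fps_X) * SF_gf (Suc k) =
      ?P * (fps_X * SF_gf k)"
    by (simp add: mult.assoc SF_gf_Suc del: fib.simps)
  also have "\<dots> = fps_X * (?P * SF_gf k)"
    by (rule mult.left_commute)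
  also have "\<dots> = fps_X ^ Suc k"
    by (simp only: Suc power_Suc)
  finally show ?case .
qed

theorem theorem11:
  fixes k :: nat
  assumes "k \<ge> 1"
  shows "Abs_fps (\<lambda>n. if n \<ge> k then (SF n k :: 'a::field_char_0 poly fract) else 0) =
    fps_X ^ k / (\<Prod>i=1..k. 1 - fps_const (qint (int (fib i))) * fps_X)"
proof -
  let ?P = "\<Prod>i=1..k. 1 - fps_const (qint (int (fib i))) * fps_X :: 'a poly fract fps"
  \<comment> \<open>The constant coefficient is 1, so no factor vanishes and \<open>?P\<close> can
    be cancelled.\<close>
  have "1 - fps_const c * fps_X \<noteq> 0" for c :: "'a poly fract"
  proof
    assume "1 - fps_const c * fps_X = 0"
    then have "(1 - fps_const c * fps_X) $ 0 = 0 $ 0"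
      by (rule arg_cong)
    then show False
      by simp
  qed
  then have "?P \<noteq> 0"
    by simp
  have "Abs_fps (\<lambda>n. if n \<ge> k then SF n k else 0) = (SF_gf k :: 'a poly fract fps)"
    by (auto simp: SF_gf_def SF_eq_0 intro!: fps_ext)
  also have "\<dots> = ?P * SF_gf k / ?P"
    using \<open>?P \<noteq> 0\<close> by simp
  also have "\<dots> = fps_X ^ k / ?P"
    by (simp only: prod_mult_SF_gf)
  finally show ?thesis .
qed

end
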